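(* The varieties $\mathcal{CHA}$ (connexive Heyting algebras) and $\mathcal{HA}$ (Heyting algebras) are term equivalent. More precisely: for every $\mathbf A=\langle A,\wedge,\vee,\rightarrow,0,1\rangle\in\mathcal{CHA}$, setting $a\Rightarrow b:=a\rightarrow(a\wedge b)$, the algebra $\mathbb{H}(\mathbf A)=\langle A,\wedge,\vee,\Rightarrow,0,1\rangle$ is a Heyting algebra; for every Heyting algebra $\mathbf B=\langle B,\wedge,\vee,\Rightarrow,0,1\rangle$, setting $a\rightarrow b:=(a\Rightarrow b)\wedge(\neg a\Rightarrow\neg b)$ (with $\neg a:=a\Rightarrow 0$), the algebra $\mathbb{C}(\mathbf B)=\langle B,\wedge,\vee,\rightarrow,0,1\rangle$ is a connexive Heyting algebra; and the maps $\mathbb H$ and $\mathbb C$ are mutually inverse, i.e. $\mathbb{C}(\mathbb{H}(\mathbf A))=\mathbf A$ for every $\mathbf A\in\mathcal{CHA}$ and $\mathbb{H}(\mathbb{C}(\mathbf B))=\mathbf B$ for every $\mathbf B\in\mathcal{HA}$.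
   Context: A connexive Heyting algebra is an algebra $\mathbf A=\langle A,\wedge,\vee,\rightarrow,0,1\rangle$ of type $\langle 2,2,2,0,0\rangle$ such that $\langle A,\wedge,\vee,0,1\rangle$ is a bounded distributive lattice with bottom $0$, top $1$ and lattice order $\le$, and, writing $\neg x:=x\rightarrow 0$, the following hold for all elements: (C1) $(x\rightarrow y)\rightarrow((y\rightarrow z)\rightarrow(x\rightarrow z))=1$; (C2) $(x\rightarrow y)\rightarrow\neg(x\rightarrow\neg y)=1$; (C3) $x\wedge(x\rightarrow y)=x\wedge y$; (C4) $x\rightarrow y\le(z\wedge x)\rightarrow(z\wedge y)$; (C5) $x\rightarrow y\le(z\vee x)\rightarrow(z\vee y)$. $\mathcal{CHA}$ denotes the variety of connexive Heyting algebras and $\mathcal{HA}$ the variety of Heyting algebras $\langle B,\wedge,\vee,\Rightarrow,0,1\rangle$, where $\Rightarrow$ is relative pseudocomplementation. *)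

theory Defs
  imports "HOL-Library.FuncSet"
begin

text \<open>
  Algebras of type (2,2,2,0,0) with an explicit carrier. The field \<open>imp\<close> holds the third binary
  operation, i.e. the connexive implication of a connexive Heyting algebra and the relative
  pseudocomplementation of a Heyting algebra.
\<close>

record 'a algebra =
  carrier :: "'a set"
  meet :: "'a \<Rightarrow> 'a \<Rightarrow> 'a"  (infixl "\<sqinter>\<index>" 70)
  join :: "'a \<Rightarrow> 'a \<Rightarrow> 'a"  (infixl "\<squnion>\<index>" 65)
  imp  :: "'a \<Rightarrow> 'a \<Rightarrow> 'a"  (infixr "\<leadsto>\<index>" 60)
  zero_elem :: 'a  ("\<zero>\<index>")
  one_elem :: 'a  ("\<one>\<index>")

definition le :: "'a algebra \<Rightarrow> 'a \<Rightarrow> 'a \<Rightarrow> bool"  (infix "\<preceq>\<index>" 50)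
  where "x \<preceq>\<^bsub>A\<^esub> y \<longleftrightarrow> x \<sqinter>\<^bsub>A\<^esub> y = x"

definition neg :: "'a algebra \<Rightarrow> 'a \<Rightarrow> 'a"  ("\<sim>\<index> _" [81] 80)
  where "\<sim>\<^bsub>A\<^esub> x = x \<leadsto>\<^bsub>A\<^esub> \<zero>\<^bsub>A\<^esub>"

text \<open>
  The operations are required to be extensional (\<open>undefined\<close> off the carrier), so that they are
  determined by their values on the carrier and equality of records is equality of algebras.
\<close>

locale algebra =
  fixes A :: "'a algebra" (structure)
  assumes meet_funcset: "meet A \<in> carrier A \<rightarrow>\<^sub>E carrier A \<rightarrow>\<^sub>E carrier A"
    and join_funcset: "join A \<in> carrier A \<rightarrow>\<^sub>E carrier A \<rightarrow>\<^sub>E carrier A"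
    and imp_funcset: "imp A \<in> carrier A \<rightarrow>\<^sub>E carrier A \<rightarrow>\<^sub>E carrier A"
    and bot_closed: "\<zero> \<in> carrier A"
    and top_closed: "\<one> \<in> carrier A"

locale bounded_lattice_algebra = algebra +
  assumes meet_assoc: "\<lbrakk>x \<in> carrier A; y \<in> carrier A; z \<in> carrier A\<rbrakk>
      \<Longrightarrow> (x \<sqinter> y) \<sqinter> z = x \<sqinter> (y \<sqinter> z)"
    and join_assoc: "\<lbrakk>x \<in> carrier A; y \<in> carrier A; z \<in> carrier A\<rbrakk>
      \<Longrightarrow> (x \<squnion> y) \<squnion> z = x \<squnion> (y \<squnion> z)"
    and meet_comm: "\<lbrakk>x \<in> carrier A; y \<in> carrier A\<rbrakk> \<Longrightarrow> x \<sqinter> y = y \<sqinter> x"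
    and join_comm: "\<lbrakk>x \<in> carrier A; y \<in> carrier A\<rbrakk> \<Longrightarrow> x \<squnion> y = y \<squnion> x"
    and meet_absorb: "\<lbrakk>x \<in> carrier A; y \<in> carrier A\<rbrakk> \<Longrightarrow> x \<sqinter> (x \<squnion> y) = x"
    and join_absorb: "\<lbrakk>x \<in> carrier A; y \<in> carrier A\<rbrakk> \<Longrightarrow> x \<squnion> (x \<sqinter> y) = x"
    and bot_least: "x \<in> carrier A \<Longrightarrow> \<zero> \<preceq> x"
    and top_greatest: "x \<in> carrier A \<Longrightarrow> x \<preceq> \<one>"

locale bounded_distrib_lattice_algebra = bounded_lattice_algebra +
  assumes meet_join_distrib: "\<lbrakk>x \<in> carrier A; y \<in> carrier A; z \<in> carrier A\<rbrakk>
      \<Longrightarrow> x \<sqinter> (y \<squnion> z) = (x \<sqinter> y) \<squnion> (x \<sqinter> z)"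

locale connexive_heyting_algebra = bounded_distrib_lattice_algebra +
  assumes C1: "\<lbrakk>x \<in> carrier A; y \<in> carrier A; z \<in> carrier A\<rbrakk>
      \<Longrightarrow> (x \<leadsto> y) \<leadsto> ((y \<leadsto> z) \<leadsto> (x \<leadsto> z)) = \<one>"
    and C2: "\<lbrakk>x \<in> carrier A; y \<in> carrier A\<rbrakk> \<Longrightarrow> (x \<leadsto> y) \<leadsto> \<sim> (x \<leadsto> \<sim> y) = \<one>"
    and C3: "\<lbrakk>x \<in> carrier A; y \<in> carrier A\<rbrakk> \<Longrightarrow> x \<sqinter> (x \<leadsto> y) = x \<sqinter> y"
    and C4: "\<lbrakk>x \<in> carrier A; y \<in> carrier A; z \<in> carrier A\<rbrakk>
      \<Longrightarrow> (x \<leadsto> y) \<preceq> ((z \<sqinter> x) \<leadsto> (z \<sqinter> y))"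
    and C5: "\<lbrakk>x \<in> carrier A; y \<in> carrier A; z \<in> carrier A\<rbrakk>
      \<Longrightarrow> (x \<leadsto> y) \<preceq> ((z \<squnion> x) \<leadsto> (z \<squnion> y))"

text \<open>
  \<open>x \<leadsto> y\<close> is the greatest \<open>z\<close> with \<open>x \<sqinter> z \<preceq> y\<close>; distributivity of the lattice is a consequence.
\<close>

locale heyting_algebra = bounded_lattice_algebra +
  assumes rel_pseudocompl: "\<lbrakk>x \<in> carrier A; y \<in> carrier A\<rbrakk> \<Longrightarrow> x \<sqinter> (x \<leadsto> y) \<preceq> y"
    and rel_pseudocompl_greatest: "\<lbrakk>x \<in> carrier A; y \<in> carrier A; z \<in> carrier A; x \<sqinter> z \<preceq> y\<rbrakk>
      \<Longrightarrow> z \<preceq> (x \<leadsto> y)"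

definition CHA :: "'a algebra set"
  where "CHA = {A. connexive_heyting_algebra A}"

definition HA :: "'a algebra set"
  where "HA = {B. heyting_algebra B}"

definition to_HA :: "'a algebra \<Rightarrow> 'a algebra"  ("\<H>")
  where "\<H> A = A\<lparr>imp := \<lambda>a\<in>carrier A. \<lambda>b\<in>carrier A. a \<leadsto>\<^bsub>A\<^esub> (a \<sqinter>\<^bsub>A\<^esub> b)\<rparr>"

definition to_CHA :: "'a algebra \<Rightarrow> 'a algebra"  ("\<C>")
  where "\<C> B = B\<lparr>imp := \<lambda>a\<in>carrier B. \<lambda>b\<in>carrier B.
    (a \<leadsto>\<^bsub>B\<^esub> b) \<sqinter>\<^bsub>B\<^esub> (\<sim>\<^bsub>B\<^esub> a \<leadsto>\<^bsub>B\<^esub> \<sim>\<^bsub>B\<^esub> b)\<rparr>"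

end

theory Submission
  imports Defs
begin

text \<open>
  In a connexive Heyting algebra, (C4) and (C5) make \<open>a \<rightarrow> a \<sqinter> b\<close> a relative pseudocomplement, and
  (C1) and (C2) give \<open>0 \<rightarrow> c \<le> \<not> c\<close>, whence \<open>a \<rightarrow> b \<le> \<not> a \<Rightarrow> \<not> b\<close>. Conversely put
  \<open>t = (a \<Rightarrow> b) \<sqinter> (\<not> a \<Rightarrow> \<not> b)\<close>. Then \<open>t \<le> a \<rightarrow> t \<sqinter> a\<close> and \<open>t \<le> t \<sqinter> b \<rightarrow> b\<close>, and
  \<open>t \<sqinter> a \<rightarrow> t \<sqinter> b = 1\<close> because \<open>t \<sqinter> a \<le> t \<sqinter> b \<le> \<not>\<not> (t \<sqinter> a)\<close> and \<open>p \<rightarrow> \<not>\<not> p = 1\<close> by (C1); (C1) composes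
  the three.

  In a Heyting algebra, \<open>(a \<Rightarrow> b) \<sqinter> (\<not> a \<Rightarrow> \<not> b)\<close> is the biconditional up to double negation. The
  parts of (C1)--(C5) that concern negated elements therefore hold by truth tables: below every
  nonzero element there is a nonzero \<open>s\<close> that lies below \<open>x\<close> or \<open>\<not> x\<close> for each of finitely many given
  \<open>x\<close>, and \<open>x \<mapsto> (s \<le> x)\<close> is a homomorphism to the truth values on such elements.
\<close>

section \<open>Closure and extensionality of the operations\<close>

context algebra
begin

lemma meet_closed [simp]: "x \<in> carrier A \<Longrightarrow> y \<in> carrier A \<Longrightarrow> x \<sqinter> y \<in> carrier A"
  using PiE_mem[OF PiE_mem[OF meet_funcset]] .

lemma join_closed [simp]: "x \<in> carrier A \<Longrightarrow> y \<in> carrier A \<Longrightarrow> x \<squnion> y \<in> carrier A"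
  using PiE_mem[OF PiE_mem[OF join_funcset]] .

lemma imp_closed [simp]: "x \<in> carrier A \<Longrightarrow> y \<in> carrier A \<Longrightarrow> x \<leadsto> y \<in> carrier A"
  using PiE_mem[OF PiE_mem[OF imp_funcset]] .

lemmas [simp] = bot_closed top_closed

lemma neg_closed [simp]: "x \<in> carrier A \<Longrightarrow> \<sim> x \<in> carrier A"
  by (simp add: neg_def)

text \<open>Off the carrier both sides are \<open>undefined\<close>. This turns pointwise identities
  into equality of algebras.\<close>

lemma imp_eqI:
  assumes "\<And>x y. x \<in> carrier A \<Longrightarrow> y \<in> carrier A \<Longrightarrow> f x y = x \<leadsto> y"
  shows "(\<lambda>x\<in>carrier A. \<lambda>y\<in>carrier A. f x y) = imp A"
proof (intro ext)
  fix x y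
  show "(\<lambda>x\<in>carrier A. \<lambda>y\<in>carrier A. f x y) x y = x \<leadsto> y"
    using assms PiE_arb[OF imp_funcset] PiE_arb[OF PiE_mem[OF imp_funcset]]
    by (cases "x \<in> carrier A"; cases "y \<in> carrier A") auto
qed

end

section \<open>Order theory of bounded lattices\<close>

context bounded_lattice_algebra
begin

lemma meet_idem: "x \<in> carrier A \<Longrightarrow> x \<sqinter> x = x"
  using meet_absorb[of x "x \<sqinter> x"] join_absorb[of x x] by simp

lemma le_refl [simp]: "x \<in> carrier A \<Longrightarrow> x \<preceq> x"
  by (simp add: le_def meet_idem)

lemma le_trans:
  "x \<preceq> y \<Longrightarrow> y \<preceq> z \<Longrightarrow> x \<in> carrier A \<Longrightarrow> y \<in> carrier A \<Longrightarrow> z \<in> carrier A \<Longrightarrow> x \<preceq> z"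
  unfolding le_def by (metis meet_assoc)

lemma le_antisym: "x \<preceq> y \<Longrightarrow> y \<preceq> x \<Longrightarrow> x \<in> carrier A \<Longrightarrow> y \<in> carrier A \<Longrightarrow> x = y"
  unfolding le_def by (metis meet_comm)

lemma meet_le2 [simp]: "x \<in> carrier A \<Longrightarrow> y \<in> carrier A \<Longrightarrow> x \<sqinter> y \<preceq> y"
  unfolding le_def by (simp add: meet_assoc meet_idem)

lemma meet_le1 [simp]: "x \<in> carrier A \<Longrightarrow> y \<in> carrier A \<Longrightarrow> x \<sqinter> y \<preceq> x"
  using meet_le2[of y x] by (simp add: meet_comm)

lemma le_meet_iff:
  "z \<in> carrier A \<Longrightarrow> x \<in> carrier A \<Longrightarrow> y \<in> carrier A \<Longrightarrow> z \<preceq> x \<sqinter> y \<longleftrightarrow> z \<preceq> x \<and> z \<preceq> y"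
  by (metis le_def le_trans meet_assoc meet_closed meet_le1 meet_le2)

lemma le_iff_join: "x \<in> carrier A \<Longrightarrow> y \<in> carrier A \<Longrightarrow> x \<preceq> y \<longleftrightarrow> x \<squnion> y = y"
  unfolding le_def by (metis join_absorb join_comm meet_absorb meet_comm)

lemma join_ge1 [simp]: "x \<in> carrier A \<Longrightarrow> y \<in> carrier A \<Longrightarrow> x \<preceq> x \<squnion> y"
  by (simp add: le_def meet_absorb)

lemma join_ge2 [simp]: "x \<in> carrier A \<Longrightarrow> y \<in> carrier A \<Longrightarrow> y \<preceq> x \<squnion> y"
  using join_ge1[of y x] by (simp add: join_comm)

lemma join_le_iff:
  "x \<in> carrier A \<Longrightarrow> y \<in> carrier A \<Longrightarrow> z \<in> carrier A \<Longrightarrow> x \<squnion> y \<preceq> z \<longleftrightarrow> x \<preceq> z \<and> y \<preceq> z"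
  by (metis join_assoc join_closed join_ge1 join_ge2 le_iff_join le_trans)

lemma le_zero_iff: "x \<in> carrier A \<Longrightarrow> x \<preceq> \<zero> \<longleftrightarrow> x = \<zero>"
  using bot_least le_antisym by auto

lemma one_le_iff: "x \<in> carrier A \<Longrightarrow> \<one> \<preceq> x \<longleftrightarrow> x = \<one>"
  using top_greatest le_antisym by auto

lemma meet_zero [simp]: "x \<in> carrier A \<Longrightarrow> x \<sqinter> \<zero> = \<zero>" "x \<in> carrier A \<Longrightarrow> \<zero> \<sqinter> x = \<zero>"
  using bot_least[of x] by (simp_all add: le_def meet_comm)

lemma meet_one [simp]: "x \<in> carrier A \<Longrightarrow> x \<sqinter> \<one> = x" "x \<in> carrier A \<Longrightarrow> \<one> \<sqinter> x = x"
  using top_greatest[of x] by (simp_all add: le_def meet_comm)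

text \<open>The lattice axioms do not mention \<open>imp\<close>, so only closure is at stake; both
  translations are updates of this shape.\<close>

lemma bounded_lattice_algebra_imp_update:
  assumes "\<And>x y. x \<in> carrier A \<Longrightarrow> y \<in> carrier A \<Longrightarrow> f x y \<in> carrier A"
  shows "bounded_lattice_algebra (A\<lparr>imp := \<lambda>x\<in>carrier A. \<lambda>y\<in>carrier A. f x y\<rparr>)"
  using assms meet_funcset join_funcset meet_assoc join_assoc meet_comm join_comm meet_absorb
    join_absorb bot_least top_greatest
  by unfold_locales (auto simp: le_def)

end

section \<open>Residuation and pseudocomplements in Heyting algebras\<close>

context heyting_algebra
begin

lemma le_imp_iff:
  assumes "x \<in> carrier A" "y \<in> carrier A" "z \<in> carrier A"
  shows "z \<preceq> x \<leadsto> y \<longleftrightarrow> x \<sqinter> z \<preceq> y"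
proof
  assume z: "z \<preceq> x \<leadsto> y"
  have "x \<sqinter> z \<preceq> x \<sqinter> (x \<leadsto> y)"
    using assms le_trans[OF meet_le2 z, of x] by (simp add: le_meet_iff)
  then show "x \<sqinter> z \<preceq> y"
    using assms le_trans[OF _ rel_pseudocompl[of x y]] by simp
qed (use assms rel_pseudocompl_greatest in blast)

text \<open>Forcing-style introduction: residuation applies the premise to
  \<open>s = x \<sqinter> z\<close>.\<close>

lemma le_impI:
  assumes "x \<in> carrier A" "y \<in> carrier A" "z \<in> carrier A"
    and "\<And>s. s \<in> carrier A \<Longrightarrow> s \<preceq> z \<Longrightarrow> s \<preceq> x \<Longrightarrow> s \<preceq> y"
  shows "z \<preceq> x \<leadsto> y"
  using assms by (simp add: le_imp_iff)

lemma le_impD: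
  assumes "z \<preceq> x \<leadsto> y" "z \<preceq> x" "x \<in> carrier A" "y \<in> carrier A" "z \<in> carrier A"
  shows "z \<preceq> y"
  using assms by (metis le_def le_imp_iff meet_comm)

lemma le_negI:
  assumes "x \<in> carrier A" "z \<in> carrier A"
    and "\<And>s. s \<in> carrier A \<Longrightarrow> s \<preceq> z \<Longrightarrow> s \<preceq> x \<Longrightarrow> s = \<zero>"
  shows "z \<preceq> \<sim> x"
  unfolding neg_def using assms by (intro le_impI) (auto simp: le_zero_iff)

lemma le_negD: "z \<preceq> \<sim> x \<Longrightarrow> z \<preceq> x \<Longrightarrow> x \<in> carrier A \<Longrightarrow> z \<in> carrier A \<Longrightarrow> z = \<zero>"
  unfolding neg_def using le_impD[of z x \<zero>] by (simp add: le_zero_iff)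

text \<open>Residuation moves \<open>x\<close> to the right-hand side, where a bound on the join
  splits into bounds on \<open>y\<close> and \<open>z\<close>.\<close>

lemma meet_join_distrib:
  assumes "x \<in> carrier A" "y \<in> carrier A" "z \<in> carrier A"
  shows "x \<sqinter> (y \<squnion> z) = (x \<sqinter> y) \<squnion> (x \<sqinter> z)"
proof (rule le_antisym)
  have "y \<preceq> x \<leadsto> (x \<sqinter> y) \<squnion> (x \<sqinter> z)" "z \<preceq> x \<leadsto> (x \<sqinter> y) \<squnion> (x \<sqinter> z)"
    using assms by (simp_all add: le_imp_iff)
  then have "y \<squnion> z \<preceq> x \<leadsto> (x \<sqinter> y) \<squnion> (x \<sqinter> z)"
    using assms by (simp add: join_le_iff)
  then show "x \<sqinter> (y \<squnion> z) \<preceq> (x \<sqinter> y) \<squnion> (x \<sqinter> z)"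
    using assms by (simp add: le_imp_iff)
  show "(x \<sqinter> y) \<squnion> (x \<sqinter> z) \<preceq> x \<sqinter> (y \<squnion> z)"
    using assms by (auto simp: join_le_iff le_meet_iff intro: le_trans[OF meet_le2])
qed (use assms in auto)

section \<open>Truth values at deciding elements\<close>

definition decides :: "'a \<Rightarrow> 'a \<Rightarrow> bool"
  where "decides s x \<longleftrightarrow> s \<preceq> x \<or> s \<preceq> \<sim> x"

lemma decides_mono:
  "decides t x \<Longrightarrow> s \<preceq> t \<Longrightarrow> s \<in> carrier A \<Longrightarrow> t \<in> carrier A \<Longrightarrow> x \<in> carrier A \<Longrightarrow> decides s x"
  unfolding decides_def by (meson le_trans neg_closed)

text \<open>Either \<open>t\<close> itself lies below \<open>\<sim> x\<close>, or
  \<open>le_negI\<close> fails at some nonzero \<open>s\<close> below both \<open>t\<close> and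
  \<open>x\<close>.\<close>

lemma exists_decides:
  assumes "t \<in> carrier A" "x \<in> carrier A" "t \<noteq> \<zero>"
  obtains s where "s \<in> carrier A" "s \<noteq> \<zero>" "s \<preceq> t" "decides s x"
proof (cases "t \<preceq> \<sim> x")
  case True
  then show ?thesis using that[of t] assms by (simp add: decides_def)
next
  case False
  then obtain s where "s \<in> carrier A" "s \<preceq> t" "s \<preceq> x" "s \<noteq> \<zero>"
    using le_negI[of x t] assms by blast
  then show ?thesis using that[of s] by (simp add: decides_def)
qed

text \<open>The truth-table principle: a nonzero \<open>t\<close> is refined three times, once per
  element, and earlier decisions survive by \<open>decides_mono\<close>.\<close>

lemma eq_zero_if_decides:
  assumes t: "t \<in> carrier A" "x \<in> carrier A" "y \<in> carrier A" "z \<in> carrier A"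
    and *: "\<And>s. s \<in> carrier A \<Longrightarrow> s \<noteq> \<zero> \<Longrightarrow> s \<preceq> t \<Longrightarrow>
      decides s x \<Longrightarrow> decides s y \<Longrightarrow> decides s z \<Longrightarrow> False"
  shows "t = \<zero>"
proof (rule ccontr)
  assume "t \<noteq> \<zero>"
  then obtain p where p: "p \<in> carrier A" "p \<noteq> \<zero>" "p \<preceq> t" "decides p x"
    using exists_decides t by metis
  then obtain q where q: "q \<in> carrier A" "q \<noteq> \<zero>" "q \<preceq> p" "decides q y"
    using exists_decides t by metis
  then obtain s where s: "s \<in> carrier A" "s \<noteq> \<zero>" "s \<preceq> q" "decides s z"
    using exists_decides t by metis
  have sp: "s \<preceq> p" using s q p le_trans by metis
  show False
    by (rule *[of s]) (use s q p t sp in \<open>auto intro: decides_mono le_trans[of s p t]\<close>)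
qed

text \<open>Only \<open>\<zero>\<close> lies below both an element and its negation, so truth values
  are read off at nonzero \<open>s\<close>.\<close>

lemma not_le_neg:
  assumes "s \<in> carrier A" "s \<noteq> \<zero>" "x \<in> carrier A" "decides s x"
  shows "s \<preceq> \<sim> x \<longleftrightarrow> \<not> s \<preceq> x"
  using assms le_negD unfolding decides_def by blast

lemma decides_neg:
  assumes "s \<in> carrier A" "x \<in> carrier A" "decides s x"
  shows "decides s (\<sim> x)"
  using assms le_negD le_trans unfolding decides_def by (metis le_negI neg_closed)

lemma decides_meet:
  assumes "s \<in> carrier A" "x \<in> carrier A" "y \<in> carrier A" "decides s x" "decides s y"
  shows "decides s (x \<sqinter> y)"
proof -
  have "s \<preceq> \<sim> (x \<sqinter> y)" if "s \<preceq> \<sim> x \<or> s \<preceq> \<sim> y"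
    using assms that
    by (intro le_negI; (simp add: le_meet_iff)?) (meson le_negD le_trans neg_closed)
  then show ?thesis using assms unfolding decides_def by (auto simp: le_meet_iff)
qed

text \<open>Disjointness is symmetric: \<open>x\<close> and \<open>y\<close> lie below
  \<open>\<sim> s\<close>, hence so does their join, and the relation is then turned back.\<close>

lemma le_neg_join:
  assumes "s \<in> carrier A" "x \<in> carrier A" "y \<in> carrier A" "s \<preceq> \<sim> x" "s \<preceq> \<sim> y"
  shows "s \<preceq> \<sim> (x \<squnion> y)"
proof -
  have "x \<squnion> y \<preceq> \<sim> s"
    using assms by (auto simp: join_le_iff intro!: le_negI) (meson le_negD le_trans neg_closed)+
  then show ?thesis
    using assms by (intro le_negI; simp?) (meson join_closed le_negD le_trans neg_closed)
qed

lemma decides_join: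
  assumes "s \<in> carrier A" "x \<in> carrier A" "y \<in> carrier A" "decides s x" "decides s y"
  shows "decides s (x \<squnion> y)"
  using assms unfolding decides_def
  by (meson join_closed join_ge1 join_ge2 le_neg_join le_trans)

text \<open>If \<open>s\<close> is below neither member, it is below both negations, hence below the
  negation of the join by \<open>le_neg_join\<close>.\<close>

lemma le_join_iff_decides:
  assumes "s \<in> carrier A" "s \<noteq> \<zero>" "x \<in> carrier A" "y \<in> carrier A" "decides s x" "decides s y"
  shows "s \<preceq> x \<squnion> y \<longleftrightarrow> s \<preceq> x \<or> s \<preceq> y"
  using assms unfolding decides_def
  by (meson join_closed join_ge1 join_ge2 le_negD le_neg_join le_trans)

section \<open>The connexive implication inside a Heyting algebra\<close>

definition cimp :: "'a \<Rightarrow> 'a \<Rightarrow> 'a"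
  where "cimp x y = (x \<leadsto> y) \<sqinter> (\<sim> x \<leadsto> \<sim> y)"

lemma cimp_closed [simp]: "x \<in> carrier A \<Longrightarrow> y \<in> carrier A \<Longrightarrow> cimp x y \<in> carrier A"
  by (simp add: cimp_def)

text \<open>The conjunct \<open>\<sim> x \<leadsto> \<sim> y\<close> is restated as a disjointness
  condition, so that its goal \<open>s = \<zero>\<close> can be settled by
  \<open>eq_zero_if_decides\<close>.\<close>

lemma le_cimpI:
  assumes "x \<in> carrier A" "y \<in> carrier A" "t \<in> carrier A"
    and "\<And>s. s \<in> carrier A \<Longrightarrow> s \<preceq> t \<Longrightarrow> s \<preceq> x \<Longrightarrow> s \<preceq> y"
    and "\<And>s. s \<in> carrier A \<Longrightarrow> s \<preceq> t \<Longrightarrow> s \<preceq> \<sim> x \<Longrightarrow> s \<preceq> y \<Longrightarrow> s = \<zero>"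
  shows "t \<preceq> cimp x y"
proof -
  have "s \<preceq> \<sim> y" if "s \<in> carrier A" "s \<preceq> t" "s \<preceq> \<sim> x" for s
    using that assms by (intro le_negI; simp?) (meson le_trans neg_closed)
  then show ?thesis
    unfolding cimp_def using assms by (auto simp: le_meet_iff intro!: le_impI)
qed

lemma le_cimpD:
  assumes "t \<preceq> cimp x y" "x \<in> carrier A" "y \<in> carrier A" "t \<in> carrier A"
  shows "t \<preceq> x \<Longrightarrow> t \<preceq> y" "t \<preceq> \<sim> x \<Longrightarrow> t \<preceq> \<sim> y"
  using assms le_impD unfolding cimp_def by (auto simp: le_meet_iff)

lemma cimp_eq_oneI:
  assumes "x \<in> carrier A" "y \<in> carrier A"
    and "\<And>s. s \<in> carrier A \<Longrightarrow> s \<preceq> x \<Longrightarrow> s \<preceq> y"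
    and "\<And>s. s \<in> carrier A \<Longrightarrow> s \<preceq> \<sim> x \<Longrightarrow> s \<preceq> y \<Longrightarrow> s = \<zero>"
  shows "cimp x y = \<one>"
  using le_cimpI[of x y \<one>] assms by (auto simp: one_le_iff)

text \<open>At deciding elements \<open>\<sim> x \<leadsto> \<sim> y\<close> is the contrapositive
  of the converse, so \<open>cimp\<close> acts as the biconditional.\<close>

lemma le_cimp_iff_decides:
  assumes "s \<in> carrier A" "s \<noteq> \<zero>" "x \<in> carrier A" "y \<in> carrier A" "decides s x" "decides s y"
  shows "s \<preceq> cimp x y \<longleftrightarrow> (s \<preceq> x \<longleftrightarrow> s \<preceq> y)"
proof
  assume "s \<preceq> cimp x y"
  then show "s \<preceq> x \<longleftrightarrow> s \<preceq> y"
    using assms le_cimpD not_le_neg by metis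
next
  assume "s \<preceq> x \<longleftrightarrow> s \<preceq> y"
  then consider "s \<preceq> x" "s \<preceq> y" | "s \<preceq> \<sim> x" "s \<preceq> \<sim> y"
    using assms not_le_neg by metis
  then show "s \<preceq> cimp x y"
  proof cases
    case 1
    show ?thesis
    proof (rule le_cimpI)
      fix r assume "r \<in> carrier A" "r \<preceq> s"
      then show "r \<preceq> y" "r \<preceq> \<sim> x \<Longrightarrow> r = \<zero>"
        using 1 assms by (meson le_trans le_negD)+
    qed (use assms in auto)
  next
    case 2
    show ?thesis
    proof (rule le_cimpI)
      fix r assume r: "r \<in> carrier A" "r \<preceq> s"
      then have "r \<preceq> \<sim> x" "r \<preceq> \<sim> y"
        using 2 assms le_trans[of r s] by auto
      then show "r \<preceq> x \<Longrightarrow> r \<preceq> y" "r \<preceq> y \<Longrightarrow> r = \<zero>"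
        using r assms le_negD bot_least by blast+
    qed (use assms in auto)
  qed
qed

text \<open>If \<open>s\<close> is not below \<open>cimp x y\<close>, then \<open>x\<close> and
  \<open>y\<close> have different truth values at \<open>s\<close>. Every nonzero \<open>r\<close>
  below \<open>s\<close> inherits these values, so \<open>r\<close> is not below
  \<open>cimp x y\<close> either.\<close>

lemma decides_cimp:
  assumes "s \<in> carrier A" "x \<in> carrier A" "y \<in> carrier A" "decides s x" "decides s y"
  shows "decides s (cimp x y)"
proof (cases "s \<preceq> cimp x y")
  case False
  have "s \<preceq> \<sim> (cimp x y)"
  proof (rule le_negI)
    fix r assume r: "r \<in> carrier A" "r \<preceq> s" "r \<preceq> cimp x y"
    show "r = \<zero>"
    proof (rule ccontr)
      assume "r \<noteq> \<zero>"
      moreover have "s \<noteq> \<zero>"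
        using False assms bot_least by auto
      moreover have "decides r x" "decides r y"
        using r assms decides_mono by blast+
      ultimately show False
        using r assms False le_cimp_iff_decides not_le_neg
        by (metis decides_def le_trans neg_closed)
    qed
  qed (use assms in auto)
  then show ?thesis by (simp add: decides_def)
qed (simp add: decides_def)

lemmas decides_intros = decides_neg decides_meet decides_join decides_cimp

lemmas decides_simps = not_le_neg le_meet_iff le_join_iff_decides le_cimp_iff_decides

section \<open>Axioms (C1) to (C5) for \<open>cimp\<close>\<close>

lemma cimp_C1:
  assumes "x \<in> carrier A" "y \<in> carrier A" "z \<in> carrier A"
  shows "cimp (cimp x y) (cimp (cimp y z) (cimp x z)) = \<one>"
proof (rule cimp_eq_oneI)
  fix s assume s: "s \<in> carrier A" "s \<preceq> cimp x y"
  show "s \<preceq> cimp (cimp y z) (cimp x z)"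
  proof (rule le_cimpI)
    fix r assume r: "r \<in> carrier A" "r \<preceq> s" "r \<preceq> cimp y z"
    have rxy: "r \<preceq> cimp x y"
      using r s assms by (meson le_trans cimp_closed)
    show "r \<preceq> cimp x z"
    proof (rule le_cimpI)
      fix q assume q: "q \<in> carrier A" "q \<preceq> r"
      have "q \<preceq> cimp x y" "q \<preceq> cimp y z"
        using q r rxy assms by (meson le_trans cimp_closed)+
      then show "q \<preceq> x \<Longrightarrow> q \<preceq> z" "q \<preceq> \<sim> x \<Longrightarrow> q \<preceq> z \<Longrightarrow> q = \<zero>"
        using q assms le_cimpD le_negD by metis+
    qed (use assms r in auto)
  next
    fix r assume r: "r \<in> carrier A" "r \<preceq> s" "r \<preceq> \<sim> (cimp y z)" "r \<preceq> cimp x z"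
    show "r = \<zero>"
    \<comment> \<open>Truth table: if \<open>x\<close> agrees with both \<open>y\<close> and
      \<open>z\<close>, then \<open>y\<close> and \<open>z\<close> agree.\<close>
    proof (rule eq_zero_if_decides[of r x y z])
      fix q assume q: "q \<in> carrier A" "q \<noteq> \<zero>" "q \<preceq> r" "decides q x" "decides q y" "decides q z"
      have "q \<preceq> s" using q r s le_trans by metis
      then have "q \<preceq> cimp x y" "q \<preceq> \<sim> (cimp y z)" "q \<preceq> cimp x z"
        using q r s assms by (meson le_trans cimp_closed neg_closed)+
      then show False
        using q assms by (auto simp: decides_simps decides_intros)
    qed (use assms r in auto)
  qed (use assms s in auto)
next
  fix s assume s: "s \<in> carrier A" "s \<preceq> \<sim> (cimp x y)" "s \<preceq> cimp (cimp y z) (cimp x z)"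
  show "s = \<zero>"
  \<comment> \<open>Truth table: the biconditional of \<open>y \<longleftrightarrow> z\<close> and
    \<open>x \<longleftrightarrow> z\<close> is \<open>x \<longleftrightarrow> y\<close>, whose
    negation is forced as well.\<close>
  proof (rule eq_zero_if_decides[of s x y z])
    fix q assume q: "q \<in> carrier A" "q \<noteq> \<zero>" "q \<preceq> s" "decides q x" "decides q y" "decides q z"
    have "q \<preceq> \<sim> (cimp x y)" "q \<preceq> cimp (cimp y z) (cimp x z)"
      using q s assms by (meson le_trans cimp_closed neg_closed)+
    then show False
      using q assms by (auto simp: decides_simps decides_intros)
  qed (use assms s in auto)
qed (use assms in auto)

text \<open>As truth functions, the biconditionals of \<open>x\<close> with \<open>y\<close> and
  with \<open>\<sim> y\<close> are complementary: never both true, never both false.\<close>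

lemma cimp_C2:
  assumes "x \<in> carrier A" "y \<in> carrier A"
  shows "cimp (cimp x y) (\<sim> (cimp x (\<sim> y))) = \<one>"
proof (rule cimp_eq_oneI)
  fix s assume s: "s \<in> carrier A" "s \<preceq> cimp x y"
  show "s \<preceq> \<sim> (cimp x (\<sim> y))"
  proof (rule le_negI)
    fix r assume r: "r \<in> carrier A" "r \<preceq> s" "r \<preceq> cimp x (\<sim> y)"
    show "r = \<zero>"
    \<comment> \<open>The table has two variables, so \<open>y\<close> also fills the third
      slot.\<close>
    proof (rule eq_zero_if_decides[of r x y y])
      fix q assume q: "q \<in> carrier A" "q \<noteq> \<zero>" "q \<preceq> r" "decides q x" "decides q y"
      have "q \<preceq> s" using q r s le_trans by metis
      then have "q \<preceq> cimp x y" "q \<preceq> cimp x (\<sim> y)"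
        using q r s assms by (meson le_trans cimp_closed neg_closed)+
      then show False
        using q assms by (auto simp: decides_simps decides_intros)
    qed (use assms r in auto)
  qed (use assms s in auto)
next
  fix s assume s: "s \<in> carrier A" "s \<preceq> \<sim> (cimp x y)" "s \<preceq> \<sim> (cimp x (\<sim> y))"
  show "s = \<zero>"
  proof (rule eq_zero_if_decides[of s x y y])
    fix q assume q: "q \<in> carrier A" "q \<noteq> \<zero>" "q \<preceq> s" "decides q x" "decides q y"
    have "q \<preceq> \<sim> (cimp x y)" "q \<preceq> \<sim> (cimp x (\<sim> y))"
      using q s assms by (meson le_trans cimp_closed neg_closed)+
    then show False
      using q assms by (auto simp: decides_simps decides_intros)
  qed (use assms s in auto)
qed (use assms in auto)

text \<open>The first conjunct of \<open>cimp\<close> gives modus ponens; below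
  \<open>x \<sqinter> y\<close> the second is vacuous, since nothing nonzero there lies below
  \<open>\<sim> x\<close>.\<close>

lemma cimp_C3:
  assumes "x \<in> carrier A" "y \<in> carrier A"
  shows "x \<sqinter> cimp x y = x \<sqinter> y"
proof (rule le_antisym)
  have "x \<sqinter> cimp x y \<preceq> y"
    using assms by (intro le_cimpD(1)[of "x \<sqinter> cimp x y" x y]) auto
  then show "x \<sqinter> cimp x y \<preceq> x \<sqinter> y"
    using assms by (simp add: le_meet_iff)
  have "x \<sqinter> y \<preceq> cimp x y"
  proof (rule le_cimpI)
    fix s assume s: "s \<in> carrier A" "s \<preceq> x \<sqinter> y"
    then have "s \<preceq> x" "s \<preceq> y"
      using assms by (simp_all add: le_meet_iff)
    then show "s \<preceq> y" "s \<preceq> \<sim> x \<Longrightarrow> s = \<zero>"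
      using s assms le_negD by blast+
  qed (use assms in auto)
  then show "x \<sqinter> y \<preceq> x \<sqinter> cimp x y"
    using assms by (simp add: le_meet_iff)
qed (use assms in auto)

lemma cimp_C4:
  assumes "x \<in> carrier A" "y \<in> carrier A" "z \<in> carrier A"
  shows "cimp x y \<preceq> cimp (z \<sqinter> x) (z \<sqinter> y)"
proof (rule le_cimpI)
  fix s assume s: "s \<in> carrier A" "s \<preceq> cimp x y"
  show "s \<preceq> z \<sqinter> y" if "s \<preceq> z \<sqinter> x"
    using that s assms by (auto simp: le_meet_iff dest: le_cimpD)
  show "s = \<zero>" if s': "s \<preceq> \<sim> (z \<sqinter> x)" "s \<preceq> z \<sqinter> y"
  \<comment> \<open>Truth table: \<open>z\<close> and \<open>y\<close> true, with \<open>x\<close>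
    agreeing with \<open>y\<close>, make \<open>z \<sqinter> x\<close> true.\<close>
  proof (rule eq_zero_if_decides[of s x y z])
    fix q assume q: "q \<in> carrier A" "q \<noteq> \<zero>" "q \<preceq> s" "decides q x" "decides q y" "decides q z"
    have "q \<preceq> cimp x y" "q \<preceq> \<sim> (z \<sqinter> x)" "q \<preceq> z \<sqinter> y"
      using q s s' assms by (meson le_trans cimp_closed meet_closed neg_closed)+
    then show False
      using q assms by (auto simp: decides_simps decides_intros)
  qed (use assms s in auto)
qed (use assms in auto)

lemma cimp_C5:
  assumes "x \<in> carrier A" "y \<in> carrier A" "z \<in> carrier A"
  shows "cimp x y \<preceq> cimp (z \<squnion> x) (z \<squnion> y)"
proof (rule le_cimpI)
  fix s assume s: "s \<in> carrier A" "s \<preceq> cimp x y"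
  show "s \<preceq> z \<squnion> y" if "s \<preceq> z \<squnion> x"
  proof -
    \<comment> \<open>Here \<open>s\<close> may decide neither \<open>z\<close> nor
      \<open>x\<close>; distributivity splits it into \<open>s \<sqinter> z\<close> and
      \<open>s \<sqinter> x\<close> instead.\<close>
    have "s \<sqinter> x \<preceq> cimp x y"
      using s assms by (auto intro: le_trans[of _ s])
    then have "s \<sqinter> x \<preceq> y"
      using s assms by (auto intro: le_cimpD)
    then have "(s \<sqinter> z) \<squnion> (s \<sqinter> x) \<preceq> z \<squnion> y"
      using s assms by (auto simp: join_le_iff intro: le_trans[of _ z] le_trans[of _ y])
    then show ?thesis
      using that s assms by (simp add: meet_join_distrib[symmetric] le_def)
  qed
  show "s = \<zero>" if s': "s \<preceq> \<sim> (z \<squnion> x)" "s \<preceq> z \<squnion> y"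
  proof (rule eq_zero_if_decides[of s x y z])
    fix q assume q: "q \<in> carrier A" "q \<noteq> \<zero>" "q \<preceq> s" "decides q x" "decides q y" "decides q z"
    have "q \<preceq> cimp x y" "q \<preceq> \<sim> (z \<squnion> x)" "q \<preceq> z \<squnion> y"
      using q s s' assms by (meson le_trans cimp_closed join_closed neg_closed)+
    then show False
      using q assms by (auto simp: decides_simps decides_intros)
  qed (use assms s in auto)
qed (use assms in auto)

section \<open>From Heyting algebras to connexive ones and back\<close>

lemma neg_zero: "\<sim> \<zero> = \<one>"
  using le_negI[of \<zero> \<one>] by (simp add: one_le_iff le_zero_iff)

text \<open>The second conjunct becomes \<open>\<sim> x \<leadsto> \<one>\<close>, which is
  \<open>\<one>\<close>. Thus (C2) for \<open>\<C> A\<close> can be stated with the negation of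
  \<open>A\<close>.\<close>

lemma cimp_zero:
  assumes "x \<in> carrier A"
  shows "cimp x \<zero> = \<sim> x"
proof -
  have "\<sim> x \<leadsto> \<one> = \<one>"
    using assms top_greatest le_impI[of "\<sim> x" \<one> \<one>] by (simp add: one_le_iff)
  then show ?thesis
    using assms by (simp add: cimp_def neg_zero flip: neg_def)
qed

text \<open>The second conjunct holds automatically, since nothing nonzero lies below both
  \<open>\<sim> x\<close> and \<open>x \<sqinter> y\<close>.\<close>

lemma cimp_meet:
  assumes "x \<in> carrier A" "y \<in> carrier A"
  shows "cimp x (x \<sqinter> y) = x \<leadsto> y"
proof (rule le_antisym)
  show "cimp x (x \<sqinter> y) \<preceq> x \<leadsto> y"
  proof (rule le_impI)
    fix s assume "s \<in> carrier A" "s \<preceq> cimp x (x \<sqinter> y)" "s \<preceq> x"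
    then show "s \<preceq> y"
      using assms le_cimpD(1)[of s x "x \<sqinter> y"] by (simp add: le_meet_iff)
  qed (use assms in auto)
  show "x \<leadsto> y \<preceq> cimp x (x \<sqinter> y)"
  proof (rule le_cimpI)
    fix s assume s: "s \<in> carrier A" "s \<preceq> x \<leadsto> y"
    show "s \<preceq> x \<sqinter> y" if "s \<preceq> x"
      using that s assms le_impD[of s x y] by (simp add: le_meet_iff)
    show "s = \<zero>" if "s \<preceq> \<sim> x" "s \<preceq> x \<sqinter> y"
      using that s assms le_negD by (simp add: le_meet_iff)
  qed (use assms in auto)
qed (use assms in auto)

lemma to_CHA_eq: "\<C> A = A\<lparr>imp := \<lambda>x\<in>carrier A. \<lambda>y\<in>carrier A. cimp x y\<rparr>"
  by (simp add: to_CHA_def cimp_def)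

lemma connexive_heyting_algebra_to_CHA: "connexive_heyting_algebra (\<C> A)"
proof -
  interpret C: bounded_lattice_algebra "\<C> A"
    unfolding to_CHA_eq by (rule bounded_lattice_algebra_imp_update) simp
  have "\<sim>\<^bsub>\<C> A\<^esub> x = \<sim> x" if "x \<in> carrier A" for x
    unfolding neg_def[of "\<C> A"] using that by (simp add: to_CHA_eq cimp_zero)
  then show ?thesis
    using meet_join_distrib cimp_C1 cimp_C2 cimp_C3 cimp_C4 cimp_C5
    by unfold_locales (simp_all add: to_CHA_eq le_def)
qed

lemma to_HA_to_CHA: "\<H> (\<C> A) = A"
proof -
  have "(\<lambda>x\<in>carrier A. \<lambda>y\<in>carrier A. cimp x (x \<sqinter> y)) = imp A"
    by (rule imp_eqI) (rule cimp_meet)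
  \<comment> \<open>The restricted \<open>cimp\<close> is evaluated only at \<open>x\<close> and
    \<open>x \<sqinter> y\<close>, both in the carrier.\<close>
  moreover have "\<H> (\<C> A) = A\<lparr>imp := \<lambda>x\<in>carrier A. \<lambda>y\<in>carrier A. cimp x (x \<sqinter> y)\<rparr>"
    by (simp add: to_HA_def to_CHA_eq cong: restrict_cong)
  ultimately show ?thesis by simp
qed

end

section \<open>Modus ponens, transitivity and residuation in connexive Heyting algebras\<close>

context connexive_heyting_algebra
begin

lemma one_imp: "x \<in> carrier A \<Longrightarrow> \<one> \<leadsto> x = x"
  using C3[of \<one> x] by simp

text \<open>The instance \<open>\<one>, \<one>, x\<close> of (C1) collapses to this, as
  \<open>\<one>\<close> is a left unit for the implication.\<close>

lemma imp_refl: "x \<in> carrier A \<Longrightarrow> x \<leadsto> x = \<one>"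
  using C1[of \<one> \<one> x] by (simp add: one_imp)

lemma imp_mp:
  assumes "t \<preceq> x \<leadsto> y" "t \<preceq> x" "x \<in> carrier A" "y \<in> carrier A" "t \<in> carrier A"
  shows "t \<preceq> y"
proof -
  have "t \<preceq> x \<sqinter> (x \<leadsto> y)" using assms by (simp add: le_meet_iff)
  then show ?thesis using assms by (simp add: C3 le_meet_iff)
qed

text \<open>Turns (C1) into an inequality. The converse fails if
  \<open>\<zero> \<noteq> \<one>\<close>, by \<open>zero_imp_one\<close>.\<close>

lemma le_if_imp_eq_one: "x \<leadsto> y = \<one> \<Longrightarrow> x \<in> carrier A \<Longrightarrow> y \<in> carrier A \<Longrightarrow> x \<preceq> y"
  using imp_mp[of x x y] top_greatest by simp

lemma imp_trans:
  assumes "t \<preceq> x \<leadsto> y" "t \<preceq> y \<leadsto> z"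
    and "x \<in> carrier A" "y \<in> carrier A" "z \<in> carrier A" "t \<in> carrier A"
  shows "t \<preceq> x \<leadsto> z"
proof -
  have "x \<leadsto> y \<preceq> (y \<leadsto> z) \<leadsto> (x \<leadsto> z)"
    using assms by (simp add: C1 le_if_imp_eq_one)
  then have "t \<preceq> (y \<leadsto> z) \<leadsto> (x \<leadsto> z)"
    using assms le_trans[of t "x \<leadsto> y"] by simp
  then show ?thesis
    using assms imp_mp[of t "y \<leadsto> z" "x \<leadsto> z"] by simp
qed

lemma le_imp_meet_iff:
  assumes "x \<in> carrier A" "y \<in> carrier A" "t \<in> carrier A"
  shows "t \<preceq> x \<leadsto> (x \<sqinter> y) \<longleftrightarrow> x \<sqinter> t \<preceq> y"
proof
  assume t: "t \<preceq> x \<leadsto> (x \<sqinter> y)"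
  have "x \<sqinter> t \<preceq> x \<sqinter> y"
    using assms le_trans[OF meet_le2 t, of x] imp_mp[of "x \<sqinter> t" x "x \<sqinter> y"] by simp
  then show "x \<sqinter> t \<preceq> y"
    using assms by (simp add: le_meet_iff)
next
  assume xt: "x \<sqinter> t \<preceq> y"
  \<comment> \<open>(C4) meets both sides of \<open>\<one> \<leadsto> t\<close>, which is
    \<open>t\<close>, with \<open>x\<close>.\<close>
  have t: "t \<preceq> x \<leadsto> (x \<sqinter> t)"
    using C4[of \<one> t x] assms by (simp add: one_imp)
  \<comment> \<open>Joining with \<open>x \<sqinter> y\<close> by (C5) keeps the antecedent
    \<open>x\<close> and enlarges the consequent to \<open>x \<sqinter> y\<close>.\<close>
  have "(x \<sqinter> y) \<squnion> x = x" "(x \<sqinter> y) \<squnion> (x \<sqinter> t) = x \<sqinter> y"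
    using assms xt le_iff_join[of "x \<sqinter> y" x] le_iff_join[of "x \<sqinter> t" "x \<sqinter> y"]
    by (simp_all add: le_meet_iff join_comm)
  then have "x \<leadsto> (x \<sqinter> t) \<preceq> x \<leadsto> (x \<sqinter> y)"
    using C5[of x "x \<sqinter> t" "x \<sqinter> y"] assms by simp
  then show "t \<preceq> x \<leadsto> (x \<sqinter> y)"
    using assms le_trans[OF t] by simp
qed

section \<open>Negation and the consequences of (C1) and (C2) for it\<close>

lemma le_neg_iff: "x \<in> carrier A \<Longrightarrow> t \<in> carrier A \<Longrightarrow> t \<preceq> \<sim> x \<longleftrightarrow> x \<sqinter> t = \<zero>"
  using le_imp_meet_iff[of x \<zero> t] by (simp add: neg_def le_zero_iff)

text \<open>In (C2) at \<open>\<zero>, \<zero>\<close>, both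
  \<open>\<zero> \<leadsto> \<zero>\<close> and \<open>\<sim> \<zero>\<close> are
  \<open>\<one>\<close>, which leaves
  \<open>\<sim> (\<zero> \<leadsto> \<one>) = \<one>\<close>.\<close>

lemma zero_imp_one: "\<zero> \<leadsto> \<one> = \<zero>"
proof -
  have "\<one> \<preceq> \<sim> (\<zero> \<leadsto> \<one>)"
    using C2[of \<zero> \<zero>] by (simp add: neg_def imp_refl one_imp)
  then show ?thesis by (simp add: le_neg_iff)
qed

lemma le_imp_one: "x \<in> carrier A \<Longrightarrow> x \<preceq> x \<leadsto> \<one>"
  using C3[of x \<one>] by (simp add: le_def)

text \<open>Composing \<open>\<zero> \<leadsto> x\<close> with \<open>x \<leadsto> \<one>\<close>,
  which holds below \<open>x\<close>, yields
  \<open>\<zero> \<leadsto> \<one> = \<zero>\<close>.\<close>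

lemma zero_imp_le_neg:
  assumes "x \<in> carrier A"
  shows "\<zero> \<leadsto> x \<preceq> \<sim> x"
proof -
  let ?s = "x \<sqinter> (\<zero> \<leadsto> x)"
  have "?s \<preceq> x \<leadsto> \<one>"
    using assms le_trans[OF meet_le1 le_imp_one, of x] by simp
  then have "?s \<preceq> \<zero> \<leadsto> \<one>"
    using assms by (intro imp_trans[of _ \<zero> x \<one>]) auto
  then show ?thesis
    using assms by (simp add: zero_imp_one le_zero_iff le_neg_iff)
qed

text \<open>This is (C1) at \<open>\<one>, x, \<zero>\<close>.\<close>

lemma imp_double_neg: "x \<in> carrier A \<Longrightarrow> x \<leadsto> \<sim> (\<sim> x) = \<one>"
  using C1[of \<one> x \<zero>] by (simp add: one_imp neg_def)

text \<open>(C4) meets both sides of \<open>x \<leadsto> \<sim> (\<sim> x)\<close> with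
  \<open>y\<close>, leaving \<open>x\<close> and \<open>y\<close>.\<close>

lemma imp_eq_oneI:
  assumes "x \<in> carrier A" "y \<in> carrier A" "x \<preceq> y" "y \<preceq> \<sim> (\<sim> x)"
  shows "x \<leadsto> y = \<one>"
proof -
  have "y \<sqinter> x = x" "y \<sqinter> \<sim> (\<sim> x) = y"
    using assms by (simp_all add: le_def meet_comm)
  then show ?thesis
    using C4[of x "\<sim> (\<sim> x)" y] assms by (simp add: imp_double_neg one_le_iff)
qed

lemma imp_le_neg_imp_neg:
  assumes "x \<in> carrier A" "y \<in> carrier A"
  shows "x \<leadsto> y \<preceq> \<sim> x \<leadsto> (\<sim> x \<sqinter> \<sim> y)"
proof -
  \<comment> \<open>By residuation, applied twice, the goal amounts to
    \<open>?c = \<zero>\<close>.\<close>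
  let ?c = "y \<sqinter> (\<sim> x \<sqinter> (x \<leadsto> y))"
  have c: "?c \<preceq> y" "?c \<preceq> \<sim> x" "?c \<preceq> x \<leadsto> y"
    using assms le_meet_iff[of ?c y "\<sim> x \<sqinter> (x \<leadsto> y)"] by (simp_all add: le_meet_iff)
  have "?c \<sqinter> x = \<zero>" "?c \<sqinter> y = ?c"
    using c assms le_neg_iff[of x ?c] by (simp_all add: meet_comm[of ?c x] le_def)
  \<comment> \<open>Meeting with \<open>?c\<close> sends \<open>x\<close> to \<open>\<zero>\<close>
    and \<open>y\<close> to \<open>?c\<close>; \<open>zero_imp_le_neg\<close> then makes
    \<open>?c\<close> disjoint from itself.\<close>
  then have "x \<leadsto> y \<preceq> \<zero> \<leadsto> ?c"
    using C4[of x y ?c] assms by simp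
  then have "?c \<preceq> \<sim> ?c"
    using assms le_trans[OF le_trans[OF c(3)] zero_imp_le_neg[of ?c]] by simp
  then have "?c = \<zero>"
    using assms le_neg_iff[of ?c ?c] by (simp add: meet_idem)
  then show ?thesis
    using assms by (simp add: le_imp_meet_iff le_neg_iff)
qed

lemma imp_eq_meet:
  assumes "x \<in> carrier A" "y \<in> carrier A"
  shows "(x \<leadsto> (x \<sqinter> y)) \<sqinter> (\<sim> x \<leadsto> (\<sim> x \<sqinter> \<sim> y)) = x \<leadsto> y" (is "?t = _")
proof (rule le_antisym)
  have t [simp]: "?t \<in> carrier A"
    using assms by simp
  have "x \<sqinter> ?t \<preceq> y" "\<sim> x \<sqinter> ?t \<preceq> \<sim> y"
    using assms by (simp_all flip: le_imp_meet_iff)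
  \<comment> \<open>An opaque name for \<open>?t\<close>; the argument uses only these two
    inequalities.\<close>
  then obtain t where t_def: "t = ?t" and t: "t \<in> carrier A" "x \<sqinter> t \<preceq> y" "\<sim> x \<sqinter> t \<preceq> \<sim> y"
    using t by blast
  have 1: "t \<preceq> x \<leadsto> (x \<sqinter> t)"
    using t assms by (simp add: le_imp_meet_iff)
  have 2: "t \<preceq> (y \<sqinter> t) \<leadsto> y"
  proof -
    have "t \<leadsto> \<one> \<preceq> (y \<sqinter> t) \<leadsto> y"
      using C4[of t \<one> y] t assms by simp
    then show ?thesis
      using t assms le_trans[OF le_imp_one] by simp
  qed
  have "(x \<sqinter> t) \<leadsto> (y \<sqinter> t) = \<one>"
  proof (rule imp_eq_oneI)
    show "x \<sqinter> t \<preceq> y \<sqinter> t"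
      using t assms by (simp add: le_meet_iff)
    \<comment> \<open>The goal amounts to \<open>?r = \<zero>\<close>. Below \<open>t\<close>,
      disjointness from \<open>x \<sqinter> t\<close> means lying below \<open>\<sim> x\<close>,
      hence below \<open>\<sim> y\<close>; but \<open>?r\<close> is also below
      \<open>y\<close>.\<close>
    let ?r = "\<sim> (x \<sqinter> t) \<sqinter> (y \<sqinter> t)"
    have r: "?r \<preceq> \<sim> (x \<sqinter> t)" "?r \<preceq> y" "?r \<preceq> t"
      using t assms le_trans[OF meet_le2 meet_le1, of "\<sim> (x \<sqinter> t)" y t]
        le_trans[OF meet_le2 meet_le2, of "\<sim> (x \<sqinter> t)" y t] by simp_all
    have "(x \<sqinter> t) \<sqinter> ?r = \<zero>"
      using r t assms le_neg_iff[of "x \<sqinter> t" ?r] by simp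
    then have "x \<sqinter> (t \<sqinter> ?r) = \<zero>"
      using t assms by (simp add: meet_assoc)
    moreover have "t \<sqinter> ?r = ?r"
      using r t assms by (simp add: le_def meet_comm[of t ?r])
    ultimately have "?r \<preceq> \<sim> x"
      using t assms by (simp add: le_neg_iff)
    then have "?r \<preceq> \<sim> x \<sqinter> t"
      using r t assms by (simp add: le_meet_iff)
    then have "?r \<preceq> \<sim> y"
      using t assms le_trans[of ?r "\<sim> x \<sqinter> t" "\<sim> y"] by simp
    then have "y \<sqinter> ?r = \<zero>"
      using t assms le_neg_iff[of y ?r] by simp
    moreover have "y \<sqinter> ?r = ?r"
      using r t assms by (simp add: le_def meet_comm[of y ?r])
    ultimately show "y \<sqinter> t \<preceq> \<sim> (\<sim> (x \<sqinter> t))"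
      using t assms by (simp add: le_neg_iff)
  qed (use t assms in auto)
  then have "t \<preceq> (x \<sqinter> t) \<leadsto> (y \<sqinter> t)"
    using t top_greatest by simp
  \<comment> \<open>Transitivity composes the chain \<open>x\<close>, \<open>x \<sqinter> t\<close>,
    \<open>y \<sqinter> t\<close>, \<open>y\<close>, each link holding at \<open>t\<close>.\<close>
  then have "t \<preceq> x \<leadsto> (y \<sqinter> t)"
    using 1 t assms by (intro imp_trans[of t x "x \<sqinter> t" "y \<sqinter> t"]) auto
  then have "t \<preceq> x \<leadsto> y"
    using 2 t assms by (intro imp_trans[of t x "y \<sqinter> t" y]) auto
  then show "?t \<preceq> x \<leadsto> y"
    using t_def by simp
  have "x \<leadsto> y \<preceq> x \<leadsto> (x \<sqinter> y)"
    using C4[of x y x] assms by (simp add: meet_idem)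
  then show "x \<leadsto> y \<preceq> ?t"
    using assms by (simp add: le_meet_iff imp_le_neg_imp_neg)
qed (use assms in auto)

section \<open>From connexive Heyting algebras to Heyting algebras and back\<close>

lemma heyting_algebra_to_HA: "heyting_algebra (\<H> A)"
proof -
  interpret H: bounded_lattice_algebra "\<H> A"
    unfolding to_HA_def by (rule bounded_lattice_algebra_imp_update) simp
  have "x \<sqinter> (x \<leadsto> (x \<sqinter> y)) \<preceq> y" if "x \<in> carrier A" "y \<in> carrier A" for x y
    using that le_imp_meet_iff[of x y "x \<leadsto> (x \<sqinter> y)"] by simp
  moreover have "z \<preceq> x \<leadsto> (x \<sqinter> y)"
    if "x \<in> carrier A" "y \<in> carrier A" "z \<in> carrier A" "x \<sqinter> z \<preceq> y" for x y z
    using that by (simp add: le_imp_meet_iff)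
  ultimately show ?thesis
    by unfold_locales (simp_all add: to_HA_def le_def)
qed

lemma to_CHA_to_HA: "\<C> (\<H> A) = A"
proof -
  let ?f = "\<lambda>x y. (x \<leadsto> (x \<sqinter> y)) \<sqinter> (\<sim> x \<leadsto> (\<sim> x \<sqinter> \<sim> y))"
  have "(\<lambda>x\<in>carrier A. \<lambda>y\<in>carrier A. ?f x y) = imp A"
    by (rule imp_eqI) (rule imp_eq_meet)
  \<comment> \<open>Negation is preserved because
    \<open>x \<sqinter> \<zero> = \<zero>\<close>.\<close>
  moreover have "\<sim>\<^bsub>\<H> A\<^esub> x = \<sim> x" if "x \<in> carrier A" for x
    using that by (simp add: neg_def to_HA_def)
  then have "\<C> (\<H> A) = A\<lparr>imp := \<lambda>x\<in>carrier A. \<lambda>y\<in>carrier A. ?f x y\<rparr>"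
    by (simp add: to_CHA_def to_HA_def cong: restrict_cong)
  ultimately show ?thesis by simp
qed

end

theorem theorem3p15:
  shows "(\<forall>A :: 'a algebra. A \<in> CHA \<longrightarrow> \<H> A \<in> HA) \<and>
         (\<forall>B :: 'a algebra. B \<in> HA \<longrightarrow> \<C> B \<in> CHA) \<and>
         (\<forall>A :: 'a algebra. A \<in> CHA \<longrightarrow> \<C> (\<H> A) = A) \<and>
         (\<forall>B :: 'a algebra. B \<in> HA \<longrightarrow> \<H> (\<C> B) = B)"
  by (simp add: CHA_def HA_def connexive_heyting_algebra.heyting_algebra_to_HA
      heyting_algebra.connexive_heyting_algebra_to_CHA
      connexive_heyting_algebra.to_CHA_to_HA heyting_algebra.to_HA_to_CHA)

end
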